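(* Let $n\geq 5$. Among all chemical trees with $n$ vertices, the path $P_{n}$ has the minimum value of $ZC_{1}^{*}$; that is, $ZC_{1}^{*}(T)\geq ZC_{1}^{*}(P_{n})$ for every chemical tree $T$ on $n$ vertices.
   Context: A chemical tree is a tree in which every vertex has degree at most $4$. For a vertex $v$ of a graph $G$, $d_v$ denotes its degree and $\tau_v$ denotes the number of vertices at distance exactly $2$ from $v$. The modified first Zagreb connection index is $ZC_{1}^{*}(G)=\sum_{v\in V(G)}d_{v}\tau_{v}$. $P_n$ denotes the path on $n$ vertices. *)

theory Defs
  imports "Graph_Theory.Graph_Theory"
begin

text \<open>
  A finite simple graph is a \<^locale>\<open>pair_graph\<close>: a finite, loop-free, symmetric digraph whose
  arcs are pairs, so that each undirected edge \<open>uv\<close> is represented by the two arcs \<open>(u,v)\<close> and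
  \<open>(v,u)\<close>. Consequently the degree of \<open>v\<close> in the undirected sense is its out-degree.
\<close>

text \<open>
  The digraph constant \<^const>\<open>tree\<close> cannot be used for undirected graphs: the closed walk
  \<open>u, v, u\<close> along a single undirected edge is a cycle of the symmetric digraph. The cycles of the
  undirected graph are exactly the digraph cycles of length at least 3.
\<close>

definition undirected_tree :: "'a pair_pre_digraph \<Rightarrow> bool" where
  "undirected_tree G \<longleftrightarrow> pair_graph G \<and> connected (with_proj G) \<and>
     \<not> (\<exists>p. pre_digraph.cycle (with_proj G) p \<and> length p \<ge> 3)"

definition degree :: "'a pair_pre_digraph \<Rightarrow> 'a \<Rightarrow> nat" where
  "degree G v = out_degree (with_proj G) v"

definition chemical_tree :: "'a pair_pre_digraph \<Rightarrow> bool" where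
  "chemical_tree G \<longleftrightarrow> undirected_tree G \<and> (\<forall>v \<in> pverts G. degree G v \<le> 4)"

text \<open>The graph distance is the shortest-path cost \<open>\<mu>\<close> for unit weights (\<open>\<infinity>\<close> if there is no walk).\<close>

definition distance :: "'a pair_pre_digraph \<Rightarrow> 'a \<Rightarrow> 'a \<Rightarrow> ereal" where
  "distance G u v = wf_digraph.\<mu> (with_proj G) (\<lambda>_. 1) u v"

definition connection_number :: "'a pair_pre_digraph \<Rightarrow> 'a \<Rightarrow> nat" where
  "connection_number G v = card {u \<in> pverts G. distance G v u = 2}"

definition ZC1_star :: "'a pair_pre_digraph \<Rightarrow> nat" where
  "ZC1_star G = (\<Sum>v \<in> pverts G. degree G v * connection_number G v)"

definition path_graph :: "nat \<Rightarrow> nat pair_pre_digraph" where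
  "path_graph n = \<lparr> pverts = {..<n},
     parcs = {(i, j). i < n \<and> j < n \<and> (j = Suc i \<or> i = Suc j)} \<rparr>"

end

theory Submission
  imports Defs
begin

text \<open>
  In a tree the connection number of \<open>v\<close> is \<open>\<Sum>u\<sim>v. d u - 1\<close>, so \<open>ZC\<^sub>1\<^sup>*\<close> is the sum of
  \<open>2 a b - a - b\<close> over all edges, where \<open>a\<close> and \<open>b\<close> are the degrees of the endpoints. For positive
  integers \<open>2 a b - a - b \<ge> 10 - 6 / a - 6 / b\<close>. Since the sum of \<open>1 / a + 1 / b\<close> over
  the edges counts every vertex once, \<open>ZC\<^sub>1\<^sup>* \<ge> 10 (n - 1) - 6 n = 4 n - 10\<close>, the value of the path.
\<close>

lemma degree_eq_card_Image: "degree G v = card (parcs G `` {v})"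
proof -
  have "out_arcs (with_proj G) v = Pair v ` (parcs G `` {v})"
    by (auto simp: out_arcs_def)
  then show ?thesis
    by (simp add: degree_def out_degree_def card_image inj_on_def)
qed

lemma (in wf_digraph) awalk_cost_unit: "awalk_cost (\<lambda>_. 1) p = real (length p)"
  by (induction p) simp_all

context pair_wf_digraph
begin

lemma awalk_length_less_2:
  assumes "awalk u p v" and "length p < 2"
  shows "u = v \<or> (u, v) \<in> parcs G"
  using assms by (cases p; cases "tl p") (auto simp: awalk_def)

lemma distance_eq_2_iff:
  assumes "u \<in> pverts G"
  shows "distance G u v = 2 \<longleftrightarrow>
    u \<noteq> v \<and> (u, v) \<notin> parcs G \<and> (\<exists>w. (u, w) \<in> parcs G \<and> (w, v) \<in> parcs G)"
    (is "_ \<longleftrightarrow> ?R")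
proof
  have dist: "distance G u v = (INF p\<in>{p. awalk u p v}. ereal (length p))"
    unfolding distance_def \<mu>_def awalk_cost_unit ..
  have le: "distance G u v \<le> ereal (length p)" if "awalk u p v" for p
    unfolding dist using that by (intro INF_lower) simp
  have ge: "ereal (real k) \<le> distance G u v" if "\<And>p. awalk u p v \<Longrightarrow> k \<le> length p" for k
    unfolding dist using that by (intro INF_greatest) simp
  show "distance G u v = 2" if ?R
  proof (rule antisym)
    from that obtain w where "(u, w) \<in> parcs G" "(w, v) \<in> parcs G"
      by blast
    then have "awalk u [(u, w), (w, v)] v"
      using assms by (auto simp: awalk_def)
    from le[OF this] show "distance G u v \<le> 2"
      by simp
    have "2 \<le> length p" if "awalk u p v" for p
      using awalk_length_less_2[OF that] \<open>?R\<close> by fastforce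
    from ge[OF this] show "2 \<le> distance G u v"
      by simp
  qed
  show ?R if two: "distance G u v = 2"
  proof (intro conjI)
    show "u \<noteq> v"
    proof
      assume "u = v"
      then have "awalk u [] v"
        using assms by (simp add: awalk_def)
      from le[OF this] two show False by simp
    qed
    show "(u, v) \<notin> parcs G"
    proof
      assume "(u, v) \<in> parcs G"
      then have "awalk u [(u, v)] v"
        using assms by (simp add: awalk_def)
      from le[OF this] two show False by simp
    qed
    show "\<exists>w. (u, w) \<in> parcs G \<and> (w, v) \<in> parcs G"
    proof (rule ccontr)
      assume no: "\<nexists>w. (u, w) \<in> parcs G \<and> (w, v) \<in> parcs G"
      have "3 \<le> length p" if p: "awalk u p v" for p
      proof (rule ccontr)
        assume "\<not> 3 \<le> length p"
        moreover have "\<not> length p < 2"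
          using awalk_length_less_2[OF p] \<open>u \<noteq> v\<close> \<open>(u, v) \<notin> parcs G\<close> by blast
        ultimately have "length p = Suc (Suc 0)"
          by linarith
        then obtain e f where "p = [e, f]"
          by (auto simp: length_Suc_conv)
        then show False
          using p no by (cases e; cases f) (auto simp: awalk_def)
      qed
      from ge[OF this] two show False by simp
    qed
  qed
qed

lemma connection_number_eq:
  assumes "v \<in> pverts G"
  shows "connection_number G v = card {u \<in> pverts G.
    v \<noteq> u \<and> (v, u) \<notin> parcs G \<and> (\<exists>w. (v, w) \<in> parcs G \<and> (w, u) \<in> parcs G)}"
  unfolding connection_number_def distance_eq_2_iff[OF assms] ..

end

context pair_graph
begin

lemma finite_Image: "finite (parcs G `` A)"
  using pair_finite_arcs by (rule finite_Image)

lemma sum_parcs: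
  "(\<Sum>(u, v)\<in>parcs G. f u v) = (\<Sum>u\<in>pverts G. \<Sum>v\<in>parcs G `` {u}. f u v)"
proof -
  have "parcs G = (SIGMA u:pverts G. parcs G `` {u})"
    by (auto intro: in_arcsD1)
  then show ?thesis
    using pair_finite_verts finite_Image by (subst sum.Sigma) auto
qed

lemma sum_parcs_swap: "(\<Sum>(u, v)\<in>parcs G. f v u) = (\<Sum>(u, v)\<in>parcs G. f u v)"
  by (rule sum.reindex_bij_witness[of _ prod.swap prod.swap]) (auto intro: arcs_symmetric)

lemma connection_number_ge:
  assumes acyc: "\<not> (\<exists>p. cycle p \<and> length p \<ge> 3)" and v: "v \<in> pverts G"
  shows "(\<Sum>w\<in>parcs G `` {v}. degree G w - 1) \<le> connection_number G v"
proof -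
  let ?N = "\<lambda>w. parcs G `` {w}"
  have triangle: False if "(a, b) \<in> parcs G" "(b, c) \<in> parcs G" "(c, a) \<in> parcs G" for a b c
  proof -
    have "awalk a [(a, b), (b, c), (c, a)] a"
      using that by (auto simp: awalk_def intro: in_arcsD1)
    then have "cycle [(a, b), (b, c), (c, a)]"
      using that by (auto simp: cycle_def dest: no_loops')
    then show False
      using acyc by (metis length_Cons list.size(3) numeral_3_eq_3 order_refl)
  qed
  have square: False
    if "(a, b) \<in> parcs G" "(b, c) \<in> parcs G" "(c, d) \<in> parcs G" "(d, a) \<in> parcs G"
      "a \<noteq> c" "b \<noteq> d" for a b c d
  proof -
    have "awalk a [(a, b), (b, c), (c, d), (d, a)] a"
      using that by (auto simp: awalk_def intro: in_arcsD1)
    then have "cycle [(a, b), (b, c), (c, d), (d, a)]"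
      using that by (auto simp: cycle_def dest: no_loops')
    moreover have "3 \<le> length [(a, b), (b, c), (c, d), (d, a)]"
      by simp
    ultimately show False
      using acyc by blast
  qed
  have "(\<Sum>w\<in>?N v. degree G w - 1) = (\<Sum>w\<in>?N v. card (?N w - {v}))"
    using arcs_symmetric by (intro sum.cong) (auto simp: degree_eq_card_Image card_Diff_singleton)
  also have "\<dots> = card (\<Union>w\<in>?N v. ?N w - {v})"
    by (rule card_UN_disjoint[symmetric])
      (auto simp: finite_Image dest: square arcs_symmetric)
  also have "\<dots> \<le> connection_number G v"
    unfolding connection_number_eq[OF v]
    using pair_finite_verts
    by (intro card_mono) (auto intro: in_arcsD2 dest: triangle arcs_symmetric)
  finally show ?thesis .
qed

lemma connected_iff_reachable:
  "connected (with_proj G) \<longleftrightarrow> pverts G \<noteq> {} \<and> (\<forall>u\<in>pverts G. \<forall>v\<in>pverts G. (u, v) \<in> (parcs G)\<^sup>*)"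
  using reachable_mk_symmetric_eq[OF pair_sym_arcs] reachable_conv'
  by (auto simp: connected_def strongly_connected_def)

text \<open>
  Every vertex other than a root has an arc to a vertex that is closer to the root; these arcs
  and their reversals are all distinct.
\<close>
lemma card_parcs_ge:
  assumes "connected (with_proj G)"
  shows "2 * (card (pverts G) - 1) \<le> card (parcs G)"
proof -
  from assms obtain r where r: "r \<in> pverts G"
    by (auto simp: connected_iff_reachable)
  define h where "h v = (LEAST k. (r, v) \<in> parcs G ^^ k)" for v
  have "\<exists>w. (v, w) \<in> parcs G \<and> h w < h v" if v: "v \<in> pverts G" "v \<noteq> r" for v
  proof -
    have "\<exists>k. (r, v) \<in> parcs G ^^ k"
      using assms r v by (auto simp: connected_iff_reachable rtrancl_power)
    then have hv: "(r, v) \<in> parcs G ^^ h v"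
      unfolding h_def by (rule LeastI_ex)
    with \<open>v \<noteq> r\<close> obtain k where k: "h v = Suc k"
      by (cases "h v") auto
    with hv obtain w where w: "(r, w) \<in> parcs G ^^ k" "(w, v) \<in> parcs G"
      by auto
    from w(1) have "h w \<le> k"
      unfolding h_def by (rule Least_le)
    with k w(2) show ?thesis
      by (auto intro: arcs_symmetric)
  qed
  then obtain par where par: "\<And>v. v \<in> pverts G - {r} \<Longrightarrow> (v, par v) \<in> parcs G \<and> h (par v) < h v"
    by (metis DiffE singletonI)
  let ?A = "(\<lambda>v. (v, par v)) ` (pverts G - {r})" and ?B = "(\<lambda>v. (par v, v)) ` (pverts G - {r})"
  have "?A \<inter> ?B = {}"
  proof -
    have False if "v \<in> pverts G - {r}" "w \<in> pverts G - {r}" "v = par w" "par v = w" for v w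
      using par[OF that(1)] par[OF that(2)] that(3,4) by auto
    then show ?thesis by auto
  qed
  then have "card (?A \<union> ?B) = card ?A + card ?B"
    using pair_finite_verts by (intro card_Un_disjoint) auto
  moreover have "card ?A = card (pverts G) - 1" "card ?B = card (pverts G) - 1"
    using r pair_finite_verts by (simp_all add: card_image inj_on_def)
  moreover have "?A \<union> ?B \<subseteq> parcs G"
    using par arcs_symmetric by auto
  ultimately show ?thesis
    using card_mono[OF pair_finite_arcs, of "?A \<union> ?B"] by simp
qed

lemma degree_pos:
  assumes "connected (with_proj G)" and "card (pverts G) \<ge> 2" and "v \<in> pverts G"
  shows "degree G v > 0"
proof -
  have "\<not> pverts G \<subseteq> {v}"
    using assms(2) card_mono[of "{v}" "pverts G"] by auto
  then obtain u where "u \<in> pverts G" "u \<noteq> v"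
    by blast
  then have "(v, u) \<in> (parcs G)\<^sup>*" "v \<noteq> u"
    using assms by (auto simp: connected_iff_reachable)
  then obtain w where "(v, w) \<in> parcs G"
    by (meson converse_rtranclE)
  then show ?thesis
    using finite_Image by (auto simp: degree_eq_card_Image card_gt_0_iff)
qed

end

text \<open>Multiplied by \<open>a b\<close>, the cases \<open>a = 1\<close> and \<open>a = 2\<close> read \<open>(b - 2) (b - 3) \<ge> 0\<close> and
  \<open>(b - 1) (b - 2) \<ge> 0\<close>.\<close>
lemma edge_weight_ge:
  fixes a b :: nat
  assumes "a > 0" "b > 0"
  shows "10 - 6 / a - 6 / b \<le> 2 * real a * real b - a - b"
proof -
  have main: "10 - 6 / x - 6 / y \<le> 2 * real x * real y - x - y" if xy: "0 < x" "x \<le> y" for x y :: nat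
  proof -
    consider "x = 1" "y = 1" | "x = 1" "y = 2" | "x = 1" "y \<ge> 3" | "x = 2" | "x \<ge> 3"
      using xy by linarith
    then show ?thesis
    proof cases
      case 3
      then have "0 \<le> (real y - 2) * (real y - 3)"
        by simp
      with 3 show ?thesis
        by (simp add: field_simps)
    next
      case 4
      with xy have "0 \<le> (real y - 1) * (real y - 2)"
        by simp
      with 4 xy show ?thesis
        by (simp add: field_simps)
    next
      case 5
      have "0 \<le> (real x - 3) * (real y - 3)"
        using 5 xy by simp
      then have "10 \<le> 2 * real x * real y - x - y"
        using 5 xy by (simp add: algebra_simps)
      moreover have "0 \<le> 6 / real x" "0 \<le> 6 / real y"
        by simp_all
      ultimately show ?thesis
        by linarith
    qed simp_all
  qed
  show ?thesis
    using main[of a b] main[of b a] assms by (cases "a \<le> b") (simp_all add: mult.commute mult.left_commute)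
qed

lemma undirected_tree_ZC1_star_ge:
  assumes tree: "undirected_tree G" and card: "card (pverts G) \<ge> 2"
  shows "4 * real (card (pverts G)) - 10 \<le> real (ZC1_star G)"
proof -
  interpret pair_graph G
    using tree by (simp add: undirected_tree_def)
  have conn: "connected (with_proj G)" and acyc: "\<not> (\<exists>p. cycle p \<and> length p \<ge> 3)"
    using tree by (auto simp: undirected_tree_def)
  let ?d = "\<lambda>v. real (degree G v)" and ?n = "real (card (pverts G))"
  have pos: "degree G v > 0" if "v \<in> pverts G" for v
    using degree_pos[OF conn card that] .
  have recip: "(\<Sum>(u, v)\<in>parcs G. 6 / ?d u) = 6 * ?n"
  proof -
    have "(\<Sum>(u, v)\<in>parcs G. 6 / ?d u) = (\<Sum>u\<in>pverts G. ?d u * (6 / ?d u))"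
      by (subst sum_parcs) (simp add: degree_eq_card_Image)
    also have "\<dots> = (\<Sum>u\<in>pverts G. 6)"
      by (rule sum.cong) (use pos in force)+
    finally show ?thesis by simp
  qed
  let ?Z = "\<Sum>(u, v)\<in>parcs G. ?d u * (?d v - 1)"
  have "10 * (2 * (?n - 1)) \<le> 10 * real (card (parcs G))"
    using of_nat_mono[OF card_parcs_ge[OF conn], where ?'a = real] card by (simp add: of_nat_diff)
  then have "8 * ?n - 20 \<le> 10 * real (card (parcs G)) - 12 * ?n"
    by simp
  also have "\<dots> = (\<Sum>(u, v)\<in>parcs G. 10) - (\<Sum>(u, v)\<in>parcs G. 6 / ?d u)
      - (\<Sum>(u, v)\<in>parcs G. 6 / ?d v)"
    using recip sum_parcs_swap[of "\<lambda>u v. 6 / ?d u"] by simp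
  also have "\<dots> = (\<Sum>(u, v)\<in>parcs G. 10 - 6 / ?d u - 6 / ?d v)"
    by (simp add: sum_subtractf case_prod_unfold)
  also have "\<dots> \<le> (\<Sum>(u, v)\<in>parcs G. 2 * ?d u * ?d v - ?d u - ?d v)"
    using pos in_arcsD1 in_arcsD2 by (intro sum_mono) (auto intro: edge_weight_ge)
  also have "\<dots> = ?Z + (\<Sum>(u, v)\<in>parcs G. ?d v * (?d u - 1))"
    unfolding sum.distrib[symmetric] by (rule sum.cong) (auto simp: algebra_simps)
  also have "\<dots> = 2 * ?Z"
    using sum_parcs_swap[of "\<lambda>u v. ?d u * (?d v - 1)"] by simp
  also have "?Z = (\<Sum>v\<in>pverts G. ?d v * (\<Sum>w\<in>parcs G `` {v}. real (degree G w - 1)))"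
    unfolding sum_parcs sum_distrib_left
  proof (intro sum.cong refl)
    fix u v assume "v \<in> parcs G `` {u}"
    then have "degree G v > 0" using pos in_arcsD2 by auto
    then show "?d u * (?d v - 1) = ?d u * real (degree G v - 1)"
      by (simp add: of_nat_diff)
  qed
  also have "\<dots> \<le> (\<Sum>v\<in>pverts G. ?d v * real (connection_number G v))"
    by (intro sum_mono mult_left_mono)
      (use connection_number_ge[OF acyc] in \<open>simp_all flip: of_nat_sum\<close>)
  also have "\<dots> = real (ZC1_star G)"
    by (simp add: ZC1_star_def)
  finally show ?thesis
    by simp
qed

lemma pverts_path_graph [simp]: "pverts (path_graph n) = {..<n}"
  by (simp add: path_graph_def)

lemma in_parcs_path_graph [simp]:
  "(i, j) \<in> parcs (path_graph n) \<longleftrightarrow> i < n \<and> j < n \<and> (j = Suc i \<or> i = Suc j)"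
  by (simp add: path_graph_def)

lemma pair_graph_path_graph: "pair_graph (path_graph n)"
proof
  have "parcs (path_graph n) \<subseteq> {..<n} \<times> {..<n}"
    by auto
  then show "finite (parcs (path_graph n))"
    by (rule finite_subset) simp
  show "symmetric (with_proj (path_graph n))"
    by (auto simp: symmetric_def sym_def)
qed auto

interpretation path: pair_graph "path_graph n" for n
  by (rule pair_graph_path_graph)

lemma connected_path_graph:
  assumes "n > 0"
  shows "connected (with_proj (path_graph n))"
proof -
  have up: "(i, i + k) \<in> (parcs (path_graph n))\<^sup>*" if "i + k < n" for i k
    using that
  proof (induction k)
    case (Suc k)
    then have "(i, i + k) \<in> (parcs (path_graph n))\<^sup>*" "(i + k, i + Suc k) \<in> parcs (path_graph n)"
      by auto
    then show ?case
      by (rule rtrancl_into_rtrancl)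
  qed simp
  have "sym ((parcs (path_graph n))\<^sup>*)"
    by (intro sym_rtrancl) (auto simp: sym_def)
  then have "(i, j) \<in> (parcs (path_graph n))\<^sup>*" if "i < n" "j < n" for i j
    using that up[of i "j - i"] up[of j "i - j"] by (cases "i \<le> j") (auto dest: symD)
  then show ?thesis
    using assms by (auto simp: path.connected_iff_reachable)
qed

lemma path_graph_walk_up:
  assumes "pcas (Suc u) p v" and "set p \<subseteq> parcs (path_graph n)" and "u \<notin> snd ` set p"
    and "distinct (Suc u # map snd p)"
  shows "v = Suc u + length p"
  using assms by (induction p arbitrary: u) fastforce+

lemma path_graph_walk_down:
  assumes "pcas u p v" and "set p \<subseteq> parcs (path_graph n)" and "Suc u \<notin> snd ` set p"
    and "distinct (u # map snd p)"
  shows "v + length p = u"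
  using assms by (induction p arbitrary: u) fastforce+

lemma pcas_append: "pcas u (p @ q) v \<longleftrightarrow> (\<exists>w. pcas u p w \<and> pcas w q v)"
  by (induction p arbitrary: u) auto

lemma pawalk_verts_eq: "pcas u p v \<Longrightarrow> pawalk_verts u p = u # map snd p"
  by (induction p arbitrary: u) auto

text \<open>A walk that never backtracks is monotone, so it cannot return next to its start.\<close>
lemma path_graph_acyclic:
  assumes "path.cycle n p"
  shows "length p < 3"
proof (rule ccontr)
  assume "\<not> length p < 3"
  from assms obtain u where p: "set p \<subseteq> parcs (path_graph n)" "pcas u p u" "distinct (map snd p)"
    by (auto simp: path.cycle_def path.awalk_def pawalk_verts_eq)
  from \<open>\<not> length p < 3\<close> obtain e q where "p = e # q" "length q \<ge> 2"
    by (cases p) auto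
  moreover from \<open>length q \<ge> 2\<close> obtain q' f where "q = q' @ [f]" "q' \<noteq> []"
    by (cases q rule: rev_cases) fastforce+
  ultimately obtain x y where pq: "p = (u, x) # q' @ [(y, u)]" and q': "pcas x q' y"
    using p(2) by (cases e; cases f) (auto simp: pcas_append)
  have x: "x = Suc u \<or> u = Suc x" and y: "y = Suc u \<or> u = Suc y"
    using p(1) pq by auto
  have dist: "u \<notin> snd ` set q'" "distinct (x # map snd q')" "set q' \<subseteq> parcs (path_graph n)"
    using p pq by auto
  from x show False
  proof
    assume "x = Suc u"
    then have "y = Suc u + length q'"
      using path_graph_walk_up[of u q' y n] q' dist by simp
    then show False using y \<open>q' \<noteq> []\<close> by simp
  next
    assume "u = Suc x"
    then have "y + length q' = x"
      using path_graph_walk_down[of x q' y n] q' dist by simp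
    then show False using y \<open>u = Suc x\<close> \<open>q' \<noteq> []\<close> by simp
  qed
qed

lemma ZC1_star_path_graph_le:
  assumes "n \<ge> 5"
  shows "real (ZC1_star (path_graph n)) \<le> 4 * real n - 10"
proof -
  let ?P = "path_graph n"
  let ?b = "\<lambda>i. 4 - (if i = 0 then 3 else 0) - (if i = 1 then 2 else 0)
    - (if i = n - 2 then 2 else 0) - (if i = n - 1 then 3 else 0 :: real)"
  have "real (degree ?P i * connection_number ?P i) \<le> ?b i" if i: "i < n" for i
  proof -
    have deg: "degree ?P i \<le> card A" if "parcs ?P `` {i} \<subseteq> A" "finite A" for A
      unfolding degree_eq_card_Image using that by (rule card_mono[rotated])
    have conn: "connection_number ?P i \<le> card A"
      if "{j. j < n \<and> (j = i + 2 \<or> i = j + 2)} \<subseteq> A" "finite A" for A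
    proof -
      have "i \<in> pverts ?P" using i by simp
      then show ?thesis
        unfolding path.connection_number_eq[OF \<open>i \<in> pverts ?P\<close>]
        by (intro card_mono \<open>finite A\<close> subset_trans[OF _ that(1)]) auto
    qed
    have bound: "real (degree ?P i * connection_number ?P i) \<le> real (card A * card B)"
      if "parcs ?P `` {i} \<subseteq> A" "finite A" "{j. j < n \<and> (j = i + 2 \<or> i = j + 2)} \<subseteq> B" "finite B"
      for A B
      using deg[OF that(1,2)] conn[OF that(3,4)] by (simp only: of_nat_le_iff mult_le_mono)
    consider "i = 0" | "i = 1" | "i = n - 2" | "i = n - 1" | "2 \<le> i" "i < n - 2"
      using i by linarith
    then show ?thesis
    proof cases
      case 1
      then show ?thesis
        using bound[of "{1}" "{2}"] assms by fastforce
    next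
      case 2
      then show ?thesis
        using bound[of "{0, 2}" "{3}"] assms by fastforce
    next
      case 3
      then have "parcs ?P `` {i} \<subseteq> {n - 3, n - 1}" "{j. j < n \<and> (j = i + 2 \<or> i = j + 2)} \<subseteq> {n - 4}"
        using assms by auto
      moreover have "card {n - 3, n - 1} = 2" "i \<noteq> 0" "i \<noteq> 1" "i \<noteq> n - 1"
        using 3 assms by (auto simp: card_insert_if)
      ultimately show ?thesis
        using bound[of "{n - 3, n - 1}" "{n - 4}"] 3 by simp
    next
      case 4
      then show ?thesis
        using bound[of "{n - 2}" "{n - 3}"] assms by fastforce
    next
      case 5
      then show ?thesis
        using bound[of "{i - 1, i + 1}" "{i - 2, i + 2}"] assms by fastforce
    qed
  qed
  then have "real (ZC1_star ?P) \<le> (\<Sum>i<n. ?b i)"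
    unfolding ZC1_star_def of_nat_sum pverts_path_graph by (intro sum_mono) simp
  also have "\<dots> = 4 * real n - 10"
    using assms by (simp add: sum_subtractf)
  finally show ?thesis .
qed

lemma chemical_tree_path_graph:
  assumes "n > 0"
  shows "chemical_tree (path_graph n)"
proof -
  have "degree (path_graph n) i \<le> 4" for i
  proof -
    have "degree (path_graph n) i \<le> card {Suc i, i - 1}"
      unfolding degree_eq_card_Image by (rule card_mono) auto
    also have "\<dots> \<le> 4"
      by (simp add: card_insert_if)
    finally show ?thesis .
  qed
  moreover have "undirected_tree (path_graph n)"
    unfolding undirected_tree_def
    using pair_graph_path_graph connected_path_graph[OF assms] path_graph_acyclic
    by (auto simp: not_le[symmetric])
  ultimately show ?thesis
    by (simp add: chemical_tree_def)
qed

theorem theorem3p1: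
  fixes n :: nat
  assumes "n \<ge> 5"
  shows "chemical_tree (path_graph n) \<and> card (pverts (path_graph n)) = n \<and>
    (\<forall>T :: 'a pair_pre_digraph. chemical_tree T \<and> card (pverts T) = n
       \<longrightarrow> ZC1_star T \<ge> ZC1_star (path_graph n))"
proof (intro conjI allI impI)
  show "chemical_tree (path_graph n)"
    using assms by (intro chemical_tree_path_graph) simp
  show "card (pverts (path_graph n)) = n"
    by simp
  fix T :: "'a pair_pre_digraph"
  assume T: "chemical_tree T \<and> card (pverts T) = n"
  then have "4 * real n - 10 \<le> real (ZC1_star T)"
    using undirected_tree_ZC1_star_ge[of T] assms by (auto simp: chemical_tree_def)
  then show "ZC1_star (path_graph n) \<le> ZC1_star T"
    using ZC1_star_path_graph_le[OF assms] by linarith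
qed

end
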